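(* Let the positive definiteness assumption and the bounded convergence assumption (both stated in the context) hold for the system $x_{t+1}=f(x_t,u_t)$, the class of cost functions $\mathcal V$ and the algorithm $\mathcal A$. Assume that, for any constant cost function $L\in\mathcal V$ with optimal steady state $(\eta,\theta)$, the set $\mathcal S=\{\theta\}$ is asymptotically stable with respect to the closed-loop dynamics $x_{t+1}=f(x_t,\mathcal A)$. If $\mathcal A$ achieves bounded dynamic regret, then for every constant cost function $L\in\mathcal V$ that satisfies $L(u,x)\ge\bar\mu\|x-\theta\|$ for any $(u,x)\in\mathbb R^m\times\mathbb R^n$ and some $\bar\mu>0$, there exists $\beta\in\mathcal{KL}^+$ such that $$\|x_t-\theta\|\le\beta(\|x_0-\theta\|,t)$$ is satisfied for all $t\in\mathbb Z_{\ge0}$ and $x_0\in\mathbb R^n$, where $x_t$ is the closed-loop trajectory starting at $x_0$ under the constant cost $L$.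
   Context: Comparison functions. $\alpha:\mathbb R_{\ge0}\to\mathbb R_{\ge0}$ is of class $\mathcal K$ if it is continuous, strictly increasing and $\alpha(0)=0$. $\sigma:\mathbb Z_{\ge0}\to\mathbb R_{\ge0}$ is of class $\mathcal L$ if it is nonincreasing and $\sigma(s)\to0$ as $s\to\infty$. $\beta:\mathbb R_{\ge0}\times\mathbb Z_{\ge0}\to\mathbb R_{\ge0}$ is of class $\mathcal{KL}$ if $\beta(\cdot,t)\in\mathcal K$ for each fixed $t$ and $\beta(s,\cdot)\in\mathcal L$ for each fixed $s$. $\beta\in\mathcal{KL}$ is a summable $\mathcal{KL}$-function ($\beta\in\mathcal{KL}^+$) if for any $s\ge0$ there exists $B(s)<\infty$ with $\sum_{t=0}^\infty\beta(s,t)\le B(s)$. $\|\cdot\|$ is the Euclidean norm and $\|x\|_{\mathcal S}=\inf_{y\in\mathcal S}\|x-y\|$. Setting. The system is $x_{t+1}=f(x_t,u_t)$ with $f:\mathbb R^n\times\mathbb R^m\to\mathbb R^n$, $t\in\mathbb Z_{\ge0}$. The cost functions $L_t:\mathbb R^m\times\mathbb R^n\to\mathbb R$ are time-varying, a priori unknown and belong to a class $\mathcal V$. The algorithm is a mapping $u_t=\mathcal A(\mathcal I_t)$ of the available information $\mathcal I_t=\{x_0,\dots,x_t,u_0,\dots,u_{t-1},L_0,\dots,L_{t-1},i_0\}$, where $i_0$ is prior information (e.g. the initialization of the algorithm); $x_{t+1}=f(x_t,\mathcal A)$ denotes the resulting closed loop. A constant cost function $L$ means $L_t=L$ for all $t$.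 Positive definiteness assumption. Every $L_t\in\mathcal V$ is positive definite with respect to a (time-varying) steady state $(\eta_t,\theta_t)\in\mathbb R^m\times\mathbb R^n$ of the system: $\theta_t=f(\theta_t,\eta_t)$, $L_t(\eta_t,\theta_t)=0$, $L_t(u,x)>0$ for all $(u,x)\ne(\eta_t,\theta_t)$; and there exists $\lambda\in\mathcal K$ with $\lambda(\|(u,x)-(\eta_t,\theta_t)\|)\le L_t(u,x)$ for all $L_t\in\mathcal V$ and all $(u,x)\in\mathbb R^m\times\mathbb R^n$. For a constant cost $L$ the steady state is written $(\eta,\theta)$. Bounded convergence assumption. $\mathcal A$ and $\mathcal V$ are such that, for any constant cost function $L$, there exist $\underline T\in\mathbb Z_{\ge0}$ and $\mu\ge1$ such that, for any $s\ge0$, there exists a closed-loop trajectory $\bar x=\{\bar x_t\}_{t=0}^\infty$ which satisfies $\mu\lim_{T\to\infty}\sum_{t=\underline T}^T\|\bar x_t-\theta\|\ge\lim_{T\to\infty}\sum_{t=\underline T}^T\phi(s,t)$, where $\phi(s,t)=\sup_{x_0,\tau}\|x_\tau-\theta\|$ subject to $\|x_0-\theta\|\le s$, $\tau\ge t$ (with $x_\tau$ the state at time $\tau$ of the closed-loop trajectory starting at $x_0$ under the constant cost $L$). Asymptotic stability. A (closed, positively invariant) set $\mathcal S$ is (globally) asymptotically stable for $x_{t+1}=f(x_t,\mathcal A)$ if there exists $\beta\in\mathcal{KL}$ such that, for any initial state $x_0\in\mathbb R^n$, $\|x_t\|_{\mathcal S}\le\beta(\|x_0\|_{\mathcal S},t)$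 for all $t\in\mathbb Z_{\ge0}$. Bounded dynamic regret. With $\mathcal R_T(x_0,u)=\sum_{t=0}^T\big(L_t(u_t,x_t)-L_t(\eta_t,\theta_t)\big)$, $\mathcal A$ achieves bounded dynamic regret if, for any initial state $x_0\in\mathbb R^n$, there exist constants $C_\eta,C_\theta,C\ge0$, independent of $T$, such that $\mathcal R_T(x_0,u)\le C_\eta\sum_{t=1}^T\|\eta_t-\eta_{t-1}\|+C_\theta\sum_{t=1}^T\|\theta_t-\theta_{t-1}\|+C$ holds for any sequence of cost functions $L_0,\dots,L_T\in\mathcal V$. *)

theory Defs
  imports "HOL-Analysis.Analysis"
begin

text \<open>Comparison functions. Functions on \<open>[0, \<infinity>)\<close> are represented by functions on
  \<^typ>\<open>real\<close> that are constrained on \<^term>\<open>{0::real..}\<close> only.\<close>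

definition class_K :: "(real \<Rightarrow> real) \<Rightarrow> bool" where
  "class_K \<alpha> \<longleftrightarrow> (\<forall>s\<ge>0. 0 \<le> \<alpha> s) \<and> continuous_on {0..} \<alpha> \<and> strict_mono_on {0..} \<alpha> \<and> \<alpha> 0 = 0"

definition class_L :: "(nat \<Rightarrow> real) \<Rightarrow> bool" where
  "class_L \<sigma> \<longleftrightarrow> (\<forall>t. 0 \<le> \<sigma> t) \<and> antimono \<sigma> \<and> \<sigma> \<longlonglongrightarrow> 0"

definition class_KL :: "(real \<Rightarrow> nat \<Rightarrow> real) \<Rightarrow> bool" where
  "class_KL \<beta> \<longleftrightarrow> (\<forall>t. class_K (\<lambda>s. \<beta> s t)) \<and> (\<forall>s\<ge>0. class_L (\<lambda>t. \<beta> s t))"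

definition class_KL_plus :: "(real \<Rightarrow> nat \<Rightarrow> real) \<Rightarrow> bool" where
  "class_KL_plus \<beta> \<longleftrightarrow> class_KL \<beta> \<and> (\<forall>s\<ge>0. \<exists>B. summable (\<beta> s) \<and> (\<Sum>t. \<beta> s t) \<le> B)"

text \<open>The system is \<open>x\<^sub>t\<^sub>+\<^sub>1 = f (x\<^sub>t, u\<^sub>t)\<close>; cost functions take their arguments in the order
  \<open>(u, x)\<close>. An algorithm maps \<open>[x\<^sub>0, \<dots>, x\<^sub>t]\<close>, \<open>[u\<^sub>0, \<dots>, u\<^sub>t\<^sub>-\<^sub>1]\<close>, \<open>[L\<^sub>0, \<dots>, L\<^sub>t\<^sub>-\<^sub>1]\<close> and the prior
  information \<open>i\<^sub>0\<close> to the input \<open>u\<^sub>t\<close>.\<close>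

type_synonym ('x, 'u) cost = "'u \<times> 'x \<Rightarrow> real"

type_synonym ('x, 'u, 'i) algorithm =
  "'x list \<Rightarrow> 'u list \<Rightarrow> ('x, 'u) cost list \<Rightarrow> 'i \<Rightarrow> 'u"

definition closed_loop ::
  "('x \<times> 'u \<Rightarrow> 'x) \<Rightarrow> ('x, 'u, 'i) algorithm \<Rightarrow> 'i \<Rightarrow> (nat \<Rightarrow> ('x, 'u) cost) \<Rightarrow>
    (nat \<Rightarrow> 'x) \<Rightarrow> (nat \<Rightarrow> 'u) \<Rightarrow> bool" where
  "closed_loop f A i0 L x u \<longleftrightarrow>
    (\<forall>t. u t = A (map x [0..<Suc t]) (map u [0..<t]) (map L [0..<t]) i0 \<and>
         x (Suc t) = f (x t, u t))"

text \<open>Every initial state has exactly one closed-loop trajectory.\<close>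

lemma closed_loop_unique:
  assumes "closed_loop f A i0 L x u" "closed_loop f A i0 L x' u'" "x 0 = x' 0"
  shows "x t = x' t \<and> u t = u' t"
proof (induction t rule: less_induct)
  case (less t)
  have xt: "x t = x' t"
  proof (cases t)
    case 0
    with assms(3) show ?thesis by simp
  next
    case (Suc k)
    then have "x k = x' k" "u k = u' k" using less.IH[of k] by auto
    then show ?thesis using assms(1,2) Suc unfolding closed_loop_def by metis
  qed
  have "map x [0..<Suc t] = map x' [0..<Suc t]" "map u [0..<t] = map u' [0..<t]"
    using less.IH xt by auto
  then have "u t = u' t"
    using assms(1,2) unfolding closed_loop_def by metis
  with xt show ?case by simp
qed

lemma closed_loop_exists: "\<exists>x u. closed_loop f A i0 L x u \<and> x 0 = x0"
proof -
  define step where "step t p =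
    (let v = A (fst p) (snd p) (map L [0..<t]) i0
     in (fst p @ [f (last (fst p), v)], snd p @ [v]))" for t p
  define h where "h = rec_nat ([x0], []) step"
  define x where "x t = last (fst (h t))" for t
  define u where "u t = A (fst (h t)) (snd (h t)) (map L [0..<t]) i0" for t
  have h0: "h 0 = ([x0], [])" and hS: "\<And>t. h (Suc t) = step t (h t)"
    by (simp_all add: h_def)
  have xS: "x (Suc t) = f (x t, u t)" for t
    by (simp add: x_def u_def hS step_def Let_def)
  have hist: "fst (h t) = map x [0..<Suc t] \<and> snd (h t) = map u [0..<t]" for t
  proof (induction t)
    case 0
    show ?case by (simp add: h0 x_def)
  next
    case (Suc t)
    have "h (Suc t) = (fst (h t) @ [x (Suc t)], snd (h t) @ [u t])"
      by (simp add: hS step_def Let_def x_def u_def)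
    with Suc show ?case by simp
  qed
  have "u t = A (map x [0..<Suc t]) (map u [0..<t]) (map L [0..<t]) i0" for t
    using hist[of t] unfolding u_def[of t] by metis
  with xS have "closed_loop f A i0 L x u"
    by (auto simp: closed_loop_def)
  moreover have "x 0 = x0" by (simp add: x_def h0)
  ultimately show ?thesis by blast
qed

text \<open>Since \<open>L \<in> V\<close> vanishes exactly at its steady state, the steady state is a function of the
  cost function; it is \<open>(\<eta> L, \<theta> L)\<close>. The norm on the product type is
  \<open>sqrt ((norm u)\<^sup>2 + (norm x)\<^sup>2)\<close>, i.e. the Euclidean norm of the stacked vector.\<close>

definition positive_definite_costs ::
  "('x::real_normed_vector \<times> 'u::real_normed_vector \<Rightarrow> 'x) \<Rightarrow> ('x, 'u) cost set \<Rightarrow>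
    (('x, 'u) cost \<Rightarrow> 'u) \<Rightarrow> (('x, 'u) cost \<Rightarrow> 'x) \<Rightarrow> bool" where
  "positive_definite_costs f V \<eta> \<theta> \<longleftrightarrow>
    (\<forall>L\<in>V. \<theta> L = f (\<theta> L, \<eta> L) \<and> L (\<eta> L, \<theta> L) = 0 \<and>
       (\<forall>u x. (u, x) \<noteq> (\<eta> L, \<theta> L) \<longrightarrow> L (u, x) > 0)) \<and>
    (\<exists>\<kappa>. class_K \<kappa> \<and> (\<forall>L\<in>V. \<forall>u x. \<kappa> (norm ((u, x) - (\<eta> L, \<theta> L))) \<le> L (u, x)))"

text \<open>The supremum and the limits below may be infinite, hence \<^typ>\<open>ennreal\<close>.\<close>

definition worst_deviation ::
  "('x::real_normed_vector \<times> 'u \<Rightarrow> 'x) \<Rightarrow> ('x, 'u, 'i) algorithm \<Rightarrow> 'i \<Rightarrow> ('x, 'u) cost \<Rightarrow>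
    'x \<Rightarrow> real \<Rightarrow> nat \<Rightarrow> ennreal" where
  "worst_deviation f A i0 L \<theta> s t =
    Sup {ennreal (norm (x \<tau> - \<theta>)) | x u \<tau>.
           closed_loop f A i0 (\<lambda>_. L) x u \<and> norm (x 0 - \<theta>) \<le> s \<and> \<tau> \<ge> t}"

definition bounded_convergence ::
  "('x::real_normed_vector \<times> 'u \<Rightarrow> 'x) \<Rightarrow> ('x, 'u, 'i) algorithm \<Rightarrow> 'i \<Rightarrow> ('x, 'u) cost set \<Rightarrow>
    (('x, 'u) cost \<Rightarrow> 'x) \<Rightarrow> bool" where
  "bounded_convergence f A i0 V \<theta> \<longleftrightarrow>
    (\<forall>L\<in>V. \<exists>T0::nat. \<exists>\<mu>::real. \<mu> \<ge> 1 \<and>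
      (\<forall>s\<ge>0. \<exists>x u. closed_loop f A i0 (\<lambda>_. L) x u \<and>
        ennreal \<mu> * lim (\<lambda>T. \<Sum>t=T0..T. ennreal (norm (x t - \<theta> L)))
          \<ge> lim (\<lambda>T. \<Sum>t=T0..T. worst_deviation f A i0 L (\<theta> L) s t)))"

text \<open>\<^term>\<open>infdist x S\<close> is the distance from \<open>x\<close> to \<open>S\<close>.\<close>

definition asymptotically_stable ::
  "('x::real_normed_vector \<times> 'u \<Rightarrow> 'x) \<Rightarrow> ('x, 'u, 'i) algorithm \<Rightarrow> 'i \<Rightarrow>
    (nat \<Rightarrow> ('x, 'u) cost) \<Rightarrow> 'x set \<Rightarrow> bool" where
  "asymptotically_stable f A i0 L S \<longleftrightarrow>
    closed S \<and>
    (\<forall>x u. closed_loop f A i0 L x u \<and> x 0 \<in> S \<longrightarrow> (\<forall>t. x t \<in> S)) \<and>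
    (\<exists>\<beta>. class_KL \<beta> \<and>
      (\<forall>x u. closed_loop f A i0 L x u \<longrightarrow> (\<forall>t. infdist (x t) S \<le> \<beta> (infdist (x 0) S) t)))"

definition regret ::
  "(('x, 'u) cost \<Rightarrow> 'u) \<Rightarrow> (('x, 'u) cost \<Rightarrow> 'x) \<Rightarrow> (nat \<Rightarrow> ('x, 'u) cost) \<Rightarrow>
    (nat \<Rightarrow> 'x) \<Rightarrow> (nat \<Rightarrow> 'u) \<Rightarrow> nat \<Rightarrow> real" where
  "regret \<eta> \<theta> L x u T = (\<Sum>t=0..T. L t (u t, x t) - L t (\<eta> (L t), \<theta> (L t)))"

definition bounded_dynamic_regret ::
  "('x::real_normed_vector \<times> 'u::real_normed_vector \<Rightarrow> 'x) \<Rightarrow> ('x, 'u, 'i) algorithm \<Rightarrow> 'i \<Rightarrow>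
    ('x, 'u) cost set \<Rightarrow> (('x, 'u) cost \<Rightarrow> 'u) \<Rightarrow> (('x, 'u) cost \<Rightarrow> 'x) \<Rightarrow> bool" where
  "bounded_dynamic_regret f A i0 V \<eta> \<theta> \<longleftrightarrow>
    (\<forall>x0. \<exists>C\<eta> C\<theta> C. C\<eta> \<ge> 0 \<and> C\<theta> \<ge> 0 \<and> C \<ge> 0 \<and>
      (\<forall>T L x u. (\<forall>t\<le>T. L t \<in> V) \<and> closed_loop f A i0 L x u \<and> x 0 = x0 \<longrightarrow>
        regret \<eta> \<theta> L x u T \<le>
          C\<eta> * (\<Sum>t=1..T. norm (\<eta> (L t) - \<eta> (L (t - 1)))) +
          C\<theta> * (\<Sum>t=1..T. norm (\<theta> (L t) - \<theta> (L (t - 1)))) + C))"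

end

theory Submission imports Defs begin

text \<open>
  Fix a constant cost \<open>L\<close> that grows at least linearly in the distance from \<open>\<theta>\<close>, and let \<open>\<phi> s t\<close> be
  the worst deviation from \<open>\<theta>\<close> at or after time \<open>t\<close> over all initial states within distance \<open>s\<close>.
  For a constant cost the path-length terms of the regret bound vanish, so along each trajectory the
  accumulated cost is bounded, and by linear growth so is the accumulated distance to \<open>\<theta>\<close>
  (\<open>deviations_summable\<close>).  The constant depends on the initial state, so on its own this says
  nothing uniform; the bounded convergence assumption closes this gap, because it dominates the tail
  sum of \<open>\<phi> s\<close> by that of one single trajectory.  Hence \<open>\<phi> s\<close> is summable for every \<open>s\<close>
  (\<open>summable_of_dominated_tail\<close>).

  The function \<open>\<phi>\<close> is monotone in both arguments, and the stability estimate makes it finite and forces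
  \<open>\<phi> s t \<rightarrow> 0\<close> as \<open>s \<rightarrow> 0\<close>, but it may jump in \<open>s\<close>.  Averaging \<open>\<phi>\<close> over the radii between \<open>s\<close> and
  \<open>2 s\<close> removes the jumps: the average is continuous in \<open>s\<close> and lies between \<open>\<phi> s t\<close> and \<open>\<phi> (2 s) t\<close>,
  so it still dominates \<open>\<phi>\<close> and remains summable.  Adding \<open>s / 2 ^ t\<close> makes it strictly increasing
  (\<open>KL_plus_majorant\<close>).
\<close>

section \<open>Continuous majorants of monotone functions\<close>

text \<open>The average of \<open>g\<close> over \<open>[s, 2 s]\<close>, with the interval rescaled to \<open>[1, 2]\<close> so that the
  formula keeps its meaning at \<open>s = 0\<close> and monotonicity in \<open>s\<close> is evident.\<close>

definition dyadic_average :: "(real \<Rightarrow> real) \<Rightarrow> real \<Rightarrow> real" where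
  "dyadic_average g s = integral {1..2} (\<lambda>r. g (s * r))"

lemma integrable_rescaled_mono:
  fixes g :: "real \<Rightarrow> real"
  assumes "mono g" "0 \<le> s"
  shows "(\<lambda>r. g (s * r)) integrable_on {a..b}"
  by (intro integrable_on_mono_on mono_onI monoD[OF assms(1)] mult_left_mono assms(2))

lemma dyadic_average_bounds:
  assumes "mono g" "0 \<le> s"
  shows "g s \<le> dyadic_average g s" "dyadic_average g s \<le> g (2 * s)"
proof -
  note int = integrable_rescaled_mono[OF assms, of 1 2]
  have "integral {1..2::real} (\<lambda>r. g s) \<le> dyadic_average g s"
    unfolding dyadic_average_def
    by (intro integral_le int monoD[OF assms(1)])
       (use assms(2) mult_left_mono[of 1 _ s] in auto)
  then show "g s \<le> dyadic_average g s" by simp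
  have "dyadic_average g s \<le> integral {1..2::real} (\<lambda>r. g (2 * s))"
    unfolding dyadic_average_def
    by (intro integral_le int monoD[OF assms(1)])
       (use assms(2) mult_left_mono[of _ 2 s] in \<open>auto simp: mult.commute\<close>)
  then show "dyadic_average g s \<le> g (2 * s)" by simp
qed

lemma dyadic_average_mono:
  assumes "mono g" "0 \<le> s" "s \<le> s'"
  shows "dyadic_average g s \<le> dyadic_average g s'"
  unfolding dyadic_average_def
  by (intro integral_le integrable_rescaled_mono monoD[OF assms(1)] mult_right_mono)
     (use assms in auto)

lemma dyadic_average_le:
  assumes "mono g" "mono h" "0 \<le> s" "\<And>r. g r \<le> h r"
  shows "dyadic_average g s \<le> dyadic_average h s"
  unfolding dyadic_average_def
  by (intro integral_le integrable_rescaled_mono) (use assms in auto)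

lemma dyadic_average_eq_increment:
  assumes "mono g" "0 < s"
  shows "dyadic_average g s = (integral {0..2 * s} g - integral {0..s} g) / s"
proof -
  have int: "g integrable_on {0..2 * s}"
    by (intro integrable_on_mono_on mono_onI monoD[OF assms(1)])
  have "(\<lambda>x. x / s) ` {s..2 * s} = {1..2}"
    using assms(2) by simp
  then have "dyadic_average g s = integral {s..2 * s} g / s"
    using integral_stretch_real[of s s "2 * s" g] assms(2)
    by (simp add: dyadic_average_def)
  moreover have "integral {0..s} g + integral {s..2 * s} g = integral {0..2 * s} g"
    using Henstock_Kurzweil_Integration.integral_combine[OF _ _ int, of s] assms(2) by simp
  ultimately show ?thesis by (simp add: algebra_simps)
qed

text \<open>Away from \<open>0\<close> the average is a difference quotient of the indefinite integral of \<open>g\<close>, which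
  is continuous however often \<open>g\<close> jumps; at \<open>0\<close> it is squeezed between \<open>g s\<close> and \<open>g (2 s)\<close>.\<close>

lemma continuous_on_dyadic_average:
  assumes g: "mono g" and g0: "(g \<longlongrightarrow> g 0) (at_right 0)"
  shows "continuous_on {0..} (dyadic_average g)"
  unfolding continuous_on_eq_continuous_within
proof
  fix s :: real assume "s \<in> {0..}"
  then consider "s = 0" | "s > 0" by fastforce
  then show "continuous (at s within {0..}) (dyadic_average g)"
  proof cases
    case 1
    have "filterlim (\<lambda>r::real. 2 * r) (at_right 0) (at_right 0)"
      unfolding filterlim_at
      by (auto intro!: tendsto_eq_intros eventually_mono[OF eventually_at_right_less[of 0]])
    then have g2: "((\<lambda>r. g (2 * r)) \<longlongrightarrow> g 0) (at_right 0)"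
      by (rule filterlim_compose[OF g0])
    have "(dyadic_average g \<longlongrightarrow> g 0) (at_right 0)"
    proof (rule tendsto_sandwich[OF _ _ g0 g2])
      show "\<forall>\<^sub>F r in at_right 0. g r \<le> dyadic_average g r"
        using eventually_at_right_less[of 0]
        by eventually_elim (auto intro: dyadic_average_bounds[OF g])
      show "\<forall>\<^sub>F r in at_right 0. dyadic_average g r \<le> g (2 * r)"
        using eventually_at_right_less[of 0]
        by eventually_elim (auto intro: dyadic_average_bounds[OF g])
    qed
    moreover have "dyadic_average g 0 = g 0"
      by (simp add: dyadic_average_def)
    ultimately show ?thesis
      using 1 by (simp add: continuous_within at_within_Ici_at_right)
  next
    case 2
    define F where "F x = integral {0..x} g" for x
    have F: "continuous_on {0..2 * (s + 1)} F"
      unfolding F_def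
      by (intro indefinite_integral_continuous_1 integrable_on_mono_on mono_onI monoD[OF g])
    have "continuous_on {0<..<s + 1} (\<lambda>x. (F (2 * x) - F x) / x)"
      by (intro continuous_intros continuous_on_compose2[OF F]) auto
    then have "continuous_on {0<..<s + 1} (dyadic_average g)"
      by (rule continuous_on_eq) (simp add: dyadic_average_eq_increment[OF g] F_def)
    then have "isCont (dyadic_average g) s"
      using 2 by (simp add: continuous_on_eq_continuous_at)
    then show ?thesis by (rule continuous_at_imp_continuous_within)
  qed
qed

text \<open>Summability survives because the dyadic average at \<open>s\<close> looks no further than \<open>2 s\<close>, where \<open>\<phi>\<close> is
  summable too.\<close>

lemma KL_plus_majorant:
  fixes \<phi> :: "real \<Rightarrow> nat \<Rightarrow> real"
  assumes nonneg: "\<And>s t. 0 \<le> \<phi> s t"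
    and mono: "\<And>t. mono (\<lambda>s. \<phi> s t)"
    and antimono: "\<And>s. antimono (\<phi> s)"
    and zero: "\<And>t. \<phi> 0 t = 0"
    and lim: "\<And>t. ((\<lambda>s. \<phi> s t) \<longlongrightarrow> 0) (at_right 0)"
    and summable: "\<And>s. 0 \<le> s \<Longrightarrow> summable (\<phi> s)"
  obtains \<beta> where "class_KL_plus \<beta>" "\<And>s t. 0 \<le> s \<Longrightarrow> \<phi> s t \<le> \<beta> s t"
proof
  \<comment> \<open>The second summand makes \<open>\<beta>\<close> strictly increasing in \<open>s\<close>, also where the average is
    constant; the geometric decay in \<open>t\<close> keeps it summable.\<close>
  define \<beta> where "\<beta> s t = dyadic_average (\<lambda>r. \<phi> r t) s + s / 2 ^ t" for s t
  show le: "\<phi> s t \<le> \<beta> s t" if "0 \<le> s" for s t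
    using dyadic_average_bounds(1)[OF mono that, of t] that
    by (simp add: \<beta>_def add_increasing2)
  have nn: "0 \<le> \<beta> s t" if "0 \<le> s" for s t
    using order_trans[OF nonneg le[OF that]] .
  have K: "class_K (\<lambda>s. \<beta> s t)" for t
    unfolding class_K_def
  proof (intro conjI)
    show "continuous_on {0..} (\<lambda>s. \<beta> s t)"
      unfolding \<beta>_def
      by (intro continuous_intros continuous_on_dyadic_average mono) (simp_all add: zero lim)
    show "strict_mono_on {0..} (\<lambda>s. \<beta> s t)"
      unfolding \<beta>_def
      by (intro strict_mono_onI add_le_less_mono dyadic_average_mono mono divide_strict_right_mono)
         auto
    show "\<beta> 0 t = 0" by (simp add: \<beta>_def dyadic_average_def zero)
  qed (use nn in blast)
  have sum: "summable (\<beta> s)" if s: "0 \<le> s" for s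
  proof (rule summable_comparison_test')
    show "summable (\<lambda>t. \<phi> (2 * s) t + s * (1 / 2) ^ t)"
      using s by (intro summable_add summable summable_mult summable_geometric) auto
    show "norm (\<beta> s t) \<le> \<phi> (2 * s) t + s * (1 / 2) ^ t" for t
      using nn[OF s, of t] dyadic_average_bounds(2)[OF mono s, of t]
      by (simp add: \<beta>_def power_one_over)
  qed
  have L: "class_L (\<beta> s)" if s: "0 \<le> s" for s
    unfolding class_L_def
  proof (intro conjI)
    show "antimono (\<beta> s)"
      unfolding \<beta>_def
      by (intro antimonoI add_mono dyadic_average_le mono s antimonoD[OF antimono]
          divide_left_mono) (use s in auto)
    show "\<beta> s \<longlonglongrightarrow> 0" by (rule summable_LIMSEQ_zero[OF sum[OF s]])
  qed (use nn s in blast)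
  show "class_KL_plus \<beta>"
    unfolding class_KL_plus_def class_KL_def using K L sum by blast
qed

section \<open>Summability of the worst deviation\<close>

lemma lim_ennreal_partial_sums:
  fixes a :: "nat \<Rightarrow> ennreal"
  shows "lim (\<lambda>T. \<Sum>t=m..T. a t) = (SUP T. \<Sum>t=m..T. a t)"
  by (intro limI LIMSEQ_SUP) (auto simp: incseq_def intro!: sum_mono2)

text \<open>The limits are taken in the extended reals, so the conclusion has to rule out that the left one
  is infinite; this is where the bound on the dominating partial sums enters.\<close>

lemma summable_of_dominated_tail:
  fixes a b :: "nat \<Rightarrow> real"
  assumes a: "\<And>t. 0 \<le> a t" and b: "\<And>t. 0 \<le> b t"
    and dom: "lim (\<lambda>T. \<Sum>t=m..T. ennreal (a t)) \<le> ennreal \<mu> * lim (\<lambda>T. \<Sum>t=m..T. ennreal (b t))"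
    and "summable b" "0 \<le> \<mu>"
  shows "summable a"
proof -
  have bB: "(\<Sum>t=m..T. ennreal (b t)) \<le> ennreal (suminf b)" for T
    using b sum_le_suminf[OF \<open>summable b\<close>, of "{m..T}"]
    by (simp add: ennreal_leI)
  have "(\<Sum>t=m..T. a t) \<le> \<mu> * suminf b" for T
  proof -
    have "ennreal (\<Sum>t=m..T. a t) = (\<Sum>t=m..T. ennreal (a t))"
      using a by simp
    also have "\<dots> \<le> (SUP T. \<Sum>t=m..T. ennreal (a t))"
      by (rule SUP_upper) simp
    also have "\<dots> \<le> ennreal \<mu> * (SUP T. \<Sum>t=m..T. ennreal (b t))"
      using dom unfolding lim_ennreal_partial_sums .
    also have "\<dots> \<le> ennreal \<mu> * ennreal (suminf b)"
      by (intro mult_left_mono SUP_least bB) simp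
    also have "\<dots> = ennreal (\<mu> * suminf b)"
      using \<open>0 \<le> \<mu>\<close> b \<open>summable b\<close> by (simp add: ennreal_mult suminf_nonneg)
    finally show ?thesis
      using \<open>0 \<le> \<mu>\<close> b \<open>summable b\<close> by (simp add: suminf_nonneg)
  qed
  moreover have "(\<Sum>t<n. a (t + m)) \<le> (\<Sum>t=m..n + m. a t)" for n
  proof -
    have "(\<Sum>t<n. a (t + m)) = (\<Sum>t\<in>(\<lambda>t. t + m) ` {..<n}. a t)"
      by (subst sum.reindex) auto
    also have "\<dots> \<le> (\<Sum>t=m..n + m. a t)"
      using a by (intro sum_mono2) auto
    finally show ?thesis .
  qed
  ultimately have "summable (\<lambda>t. a (t + m))"
    using a by (intro summableI_nonneg_bounded) (auto intro: order_trans)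
  then show ?thesis by simp
qed

text \<open>A constant cost has a constant steady state, so both path lengths in the regret bound are zero
  and the constant \<open>C\<close> belonging to the initial state of the trajectory alone bounds the accumulated
  cost.\<close>

lemma deviations_summable:
  fixes L :: "('x::real_normed_vector, 'u::real_normed_vector) cost"
  assumes "positive_definite_costs f V \<eta> \<theta>" "bounded_dynamic_regret f A i0 V \<eta> \<theta>" "L \<in> V"
    and cl: "closed_loop f A i0 (\<lambda>_. L) x u"
    and \<mu>: "0 < \<mu>" "\<And>u x. \<mu> * norm (x - \<theta> L) \<le> L (u, x)"
  shows "summable (\<lambda>t. norm (x t - \<theta> L))"
proof -
  have L0: "L (\<eta> L, \<theta> L) = 0"
    using assms(1,3) by (simp add: positive_definite_costs_def)
  obtain C\<eta> C\<theta> C where "\<forall>T L' y v. (\<forall>t\<le>T. L' t \<in> V) \<and> closed_loop f A i0 L' y v \<and> y 0 = x 0 \<longrightarrow>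
      regret \<eta> \<theta> L' y v T \<le>
        C\<eta> * (\<Sum>t=1..T. norm (\<eta> (L' t) - \<eta> (L' (t - 1)))) +
        C\<theta> * (\<Sum>t=1..T. norm (\<theta> (L' t) - \<theta> (L' (t - 1)))) + C"
    using assms(2)[unfolded bounded_dynamic_regret_def, THEN spec[of _ "x 0"]] by blast
  from this[THEN spec, THEN spec[of _ "\<lambda>_. L"], THEN spec[of _ x], THEN spec[of _ u]]
  have cost: "(\<Sum>t=0..T. L (u t, x t)) \<le> C" for T
    using assms(3) cl by (simp add: regret_def L0)
  have "(\<Sum>t<n. norm (x t - \<theta> L)) \<le> C / \<mu>" for n
  proof -
    have "(\<Sum>t<n. norm (x t - \<theta> L)) \<le> (\<Sum>t=0..n. norm (x t - \<theta> L))"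
      by (intro sum_mono2) auto
    moreover have "\<mu> * (\<Sum>t=0..n. norm (x t - \<theta> L)) \<le> (\<Sum>t=0..n. L (u t, x t))"
      unfolding sum_distrib_left by (intro sum_mono \<mu>(2))
    ultimately have "\<mu> * (\<Sum>t<n. norm (x t - \<theta> L)) \<le> C"
      using cost[of n] \<mu>(1) by (meson less_imp_le mult_left_mono order_trans)
    then show ?thesis
      using \<mu>(1) by (simp add: pos_le_divide_eq mult.commute)
  qed
  then show ?thesis by (intro summableI_nonneg_bounded) auto
qed

lemma worst_deviation_mono:
  assumes "s \<le> s'" "t' \<le> t"
  shows "worst_deviation f A i0 L c s t \<le> worst_deviation f A i0 L c s' t'"
  unfolding worst_deviation_def
  by (rule Sup_subset_mono) (use assms in \<open>blast intro: order_trans\<close>)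

lemma deviation_le_worst_deviation:
  assumes "closed_loop f A i0 (\<lambda>_. L) x u"
  shows "ennreal (norm (x t - c)) \<le> worst_deviation f A i0 L c (norm (x 0 - c)) t"
  unfolding worst_deviation_def by (rule Sup_upper) (use assms in blast)

text \<open>A bound along single trajectories passes to the supremum because \<open>\<beta>\<close> increases with the radius
  and decreases with time.\<close>

lemma worst_deviation_le_KL:
  assumes \<beta>: "class_KL \<beta>"
    and bound: "\<And>x u t. closed_loop f A i0 (\<lambda>_. L) x u \<Longrightarrow> norm (x t - c) \<le> \<beta> (norm (x 0 - c)) t"
    and s: "0 \<le> s"
  shows "worst_deviation f A i0 L c s t \<le> ennreal (\<beta> s t)"
  unfolding worst_deviation_def
proof (rule Sup_least, clarify)
  fix x u \<tau>
  assume cl: "closed_loop f A i0 (\<lambda>_. L) x u" and x0: "norm (x 0 - c) \<le> s" and \<tau>: "t \<le> \<tau>"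
  have "strict_mono_on {0..} (\<lambda>s. \<beta> s \<tau>)" "antimono (\<beta> s)"
    using \<beta> s by (simp_all add: class_KL_def class_K_def class_L_def)
  then have "\<beta> (norm (x 0 - c)) \<tau> \<le> \<beta> s \<tau>" "\<beta> s \<tau> \<le> \<beta> s t"
    using x0 \<tau> s strict_mono_on_leD[of "{0..}" "\<lambda>s. \<beta> s \<tau>" "norm (x 0 - c)" s]
    by (auto simp: antimono_def)
  with bound[OF cl, of \<tau>] show "ennreal (norm (x \<tau> - c)) \<le> ennreal (\<beta> s t)"
    by (intro ennreal_leI) linarith
qed

section \<open>Summable convergence\<close>

theorem proposition1:
  fixes f :: "(real ^ 'n) \<times> (real ^ 'm) \<Rightarrow> real ^ 'n"
    and V :: "(real ^ 'n, real ^ 'm) cost set"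
    and A :: "(real ^ 'n, real ^ 'm, 'i) algorithm"
    and i0 :: 'i
    and \<eta> :: "(real ^ 'n, real ^ 'm) cost \<Rightarrow> real ^ 'm"
    and \<theta> :: "(real ^ 'n, real ^ 'm) cost \<Rightarrow> real ^ 'n"
  assumes "positive_definite_costs f V \<eta> \<theta>"
    and "bounded_convergence f A i0 V \<theta>"
    and "\<And>L. L \<in> V \<Longrightarrow> asymptotically_stable f A i0 (\<lambda>_. L) {\<theta> L}"
    and "bounded_dynamic_regret f A i0 V \<eta> \<theta>"
  shows "\<forall>L\<in>V. (\<exists>\<mu>>0. \<forall>u x. L (u, x) \<ge> \<mu> * norm (x - \<theta> L)) \<longrightarrow>
    (\<exists>\<beta>. class_KL_plus \<beta> \<and>
      (\<forall>x u. closed_loop f A i0 (\<lambda>_. L) x u \<longrightarrow>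
        (\<forall>t. norm (x t - \<theta> L) \<le> \<beta> (norm (x 0 - \<theta> L)) t)))"
proof (intro ballI impI)
  fix L assume L: "L \<in> V" and "\<exists>\<mu>>0. \<forall>u x. L (u, x) \<ge> \<mu> * norm (x - \<theta> L)"
  then obtain \<mu> where \<mu>: "0 < \<mu>" "\<And>u x. \<mu> * norm (x - \<theta> L) \<le> L (u, x)" by blast
  define W where "W = worst_deviation f A i0 L (\<theta> L)"
  define \<phi> where "\<phi> s t = enn2real (W s t)" for s t
  obtain \<beta>\<^sub>0 where KL: "class_KL \<beta>\<^sub>0"
    and stab: "\<And>x u t. closed_loop f A i0 (\<lambda>_. L) x u \<Longrightarrow>
      norm (x t - \<theta> L) \<le> \<beta>\<^sub>0 (norm (x 0 - \<theta> L)) t"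
    using assms(3)[OF L] by (simp add: asymptotically_stable_def dist_norm) blast
  have KL_nonneg: "0 \<le> \<beta>\<^sub>0 s t" if "0 \<le> s" for s t
    using KL that by (simp add: class_KL_def class_K_def)
  have W_le: "W s t \<le> ennreal (\<beta>\<^sub>0 s t)" if "0 \<le> s" for s t
    unfolding W_def by (rule worst_deviation_le_KL[OF KL stab that])
  have W_mono: "W s t \<le> W s' t'" if "s \<le> s'" "t' \<le> t" for s s' t t'
    unfolding W_def by (rule worst_deviation_mono[OF that])
  \<comment> \<open>For \<open>s < 0\<close> the supremum ranges over the empty set; comparing with \<open>max s 0\<close> lets \<open>\<phi>\<close> be monotone
    on the whole real line.\<close>
  have W_finite: "W s t < top" for s t
  proof -
    have "W s t \<le> W (max s 0) t" by (rule W_mono) auto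
    also have "\<dots> \<le> ennreal (\<beta>\<^sub>0 (max s 0) t)" by (rule W_le) simp
    finally show ?thesis by (rule order.strict_trans1) simp
  qed
  then have W_eq: "W s t = ennreal (\<phi> s t)" for s t
    by (simp add: \<phi>_def)
  have \<phi>_mono: "\<phi> s t \<le> \<phi> s' t'" if "s \<le> s'" "t' \<le> t" for s s' t t'
    unfolding \<phi>_def using W_finite by (intro enn2real_mono W_mono that) auto
  have \<phi>_le: "\<phi> s t \<le> \<beta>\<^sub>0 s t" if "0 \<le> s" for s t
    unfolding \<phi>_def using W_le[OF that] KL_nonneg[OF that] by (rule enn2real_leI[rotated])
  have \<phi>_nonneg: "0 \<le> \<phi> s t" for s t
    by (simp add: \<phi>_def)
  have KL0: "\<beta>\<^sub>0 0 t = 0" "((\<lambda>s. \<beta>\<^sub>0 s t) \<longlongrightarrow> 0) (at_right 0)" for t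
  proof -
    have K: "class_K (\<lambda>s. \<beta>\<^sub>0 s t)" using KL by (simp add: class_KL_def)
    then show "\<beta>\<^sub>0 0 t = 0" by (simp add: class_K_def)
    have "((\<lambda>s. \<beta>\<^sub>0 s t) \<longlongrightarrow> \<beta>\<^sub>0 0 t) (at 0 within {0..})"
      using K unfolding class_K_def continuous_on_def by (elim conjE bspec) simp
    with \<open>\<beta>\<^sub>0 0 t = 0\<close> show "((\<lambda>s. \<beta>\<^sub>0 s t) \<longlongrightarrow> 0) (at_right 0)"
      by (simp add: at_within_Ici_at_right)
  qed
  have \<phi>_summable: "summable (\<phi> s)" if s: "0 \<le> s" for s
  proof -
    obtain T0 and \<nu> :: real and x u where "\<nu> \<ge> 1" and cl: "closed_loop f A i0 (\<lambda>_. L) x u"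
      and "lim (\<lambda>T. \<Sum>t=T0..T. W s t) \<le>
        ennreal \<nu> * lim (\<lambda>T. \<Sum>t=T0..T. ennreal (norm (x t - \<theta> L)))"
      using assms(2) L s unfolding bounded_convergence_def W_def by blast
    then show ?thesis
      using deviations_summable[OF assms(1,4) L cl \<mu>]
      by (intro summable_of_dominated_tail[of "\<phi> s" "\<lambda>t. norm (x t - \<theta> L)" T0 \<nu>])
         (simp_all add: W_eq \<phi>_nonneg)
  qed
  have \<phi>_lim: "((\<lambda>s. \<phi> s t) \<longlongrightarrow> 0) (at_right 0)" for t
  proof (rule tendsto_sandwich[where f = "\<lambda>_. 0" and h = "\<lambda>s. \<beta>\<^sub>0 s t"])
    show "((\<lambda>s. \<beta>\<^sub>0 s t) \<longlongrightarrow> 0) (at_right 0)"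
      by (rule KL0(2))
    show "\<forall>\<^sub>F s in at_right 0. \<phi> s t \<le> \<beta>\<^sub>0 s t"
      using eventually_at_right_less[of 0] by eventually_elim (simp add: \<phi>_le)
  qed (simp_all add: \<phi>_nonneg)
  have \<phi>_zero: "\<phi> 0 t = 0" for t
    using \<phi>_le[of 0 t] \<phi>_nonneg[of 0 t] KL0(1)[of t] by simp
  obtain \<beta> where \<beta>: "class_KL_plus \<beta>" "\<And>s t. 0 \<le> s \<Longrightarrow> \<phi> s t \<le> \<beta> s t"
    using KL_plus_majorant[of \<phi>, OF \<phi>_nonneg monoI antimonoI \<phi>_zero \<phi>_lim \<phi>_summable]
      \<phi>_mono by blast
  have "norm (x t - \<theta> L) \<le> \<beta> (norm (x 0 - \<theta> L)) t" if "closed_loop f A i0 (\<lambda>_. L) x u" for x u t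
    using deviation_le_worst_deviation[OF that, of t "\<theta> L"] \<beta>(2)[of "norm (x 0 - \<theta> L)" t]
    unfolding W_def[symmetric] W_eq by (simp add: \<phi>_nonneg)
  with \<beta>(1) show "\<exists>\<beta>. class_KL_plus \<beta> \<and>
      (\<forall>x u. closed_loop f A i0 (\<lambda>_. L) x u \<longrightarrow>
        (\<forall>t. norm (x t - \<theta> L) \<le> \<beta> (norm (x 0 - \<theta> L)) t))"
    by blast
qed

end
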